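(* Let $X(t)$, $t\ge 0$, be a symmetric Lévy process in $\mathbb{R}^d$ starting at the origin, such that $\langle X(1),u\rangle$ has a non-atomic distribution for each $u\in\mathbb{R}^d$, $u\ne 0$. For $s>0$ let $Z_s$ be the closed convex hull of $\{X(t):0\le t\le s\}$. Then $\mathbf{P}\{0\in\operatorname{Int}Z_s\}=1$ and $\mathbf{P}\{X(s)\in\operatorname{Int}Z_s\}=1$ for each $s>0$.
   Context: $\operatorname{Int}$ denotes the topological interior in $\mathbb{R}^d$. The process is symmetric if $X(t)$ and $-X(t)$ have the same distribution for every $t$. A distribution on $\mathbb{R}$ is non-atomic if every single point has probability zero. *)

theory Defs
  imports "HOL-Probability.Probability"
begin

definition cadlag :: "(real \<Rightarrow> 'a::topological_space) \<Rightarrow> bool" where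
  "cadlag f \<longleftrightarrow>
     (\<forall>t\<ge>0. (f \<longlongrightarrow> f t) (at_right t)) \<and> (\<forall>t>0. \<exists>l. (f \<longlongrightarrow> l) (at_left t))"

(* Time is the half-line: values X t with t < 0 are junk and every axiom ignores them.
   As the process starts at 0 almost surely, the independence axiom also covers the family
   X(t_0), X(t_1) - X(t_0), ..., by prepending the time 0. *)
locale levy_process = prob_space M
  for M :: "'w measure" +
  fixes X :: "real \<Rightarrow> 'w \<Rightarrow> real ^ 'd"
  assumes random_variable_X: "\<And>t. 0 \<le> t \<Longrightarrow> random_variable borel (X t)"
    and starts_at_origin: "AE \<omega> in M. X 0 \<omega> = 0"
    and independent_increments:
      "\<And>(n::nat) t. 0 \<le> t 0 \<Longrightarrow> strict_mono_on {..n} t \<Longrightarrow>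
         indep_vars (\<lambda>_. borel) (\<lambda>i \<omega>. X (t (Suc i)) \<omega> - X (t i) \<omega>) {..<n}"
    and stationary_increments:
      "\<And>t h. 0 \<le> t \<Longrightarrow> 0 \<le> h \<Longrightarrow>
         distr M borel (\<lambda>\<omega>. X (t + h) \<omega> - X t \<omega>) = distr M borel (\<lambda>\<omega>. X h \<omega> - X 0 \<omega>)"
    and stochastically_continuous:
      "\<And>t \<epsilon>. 0 \<le> t \<Longrightarrow> 0 < \<epsilon> \<Longrightarrow>
         ((\<lambda>r. \<P>(\<omega> in M. norm (X r \<omega> - X t \<omega>) > \<epsilon>)) \<longlongrightarrow> 0) (at t within {0..})"
    and cadlag_paths: "AE \<omega> in M. cadlag (\<lambda>t. X t \<omega>)"

definition symmetric_process ::
    "'w measure \<Rightarrow> (real \<Rightarrow> 'w \<Rightarrow> 'a::real_normed_vector) \<Rightarrow> bool" where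
  "symmetric_process M X \<longleftrightarrow>
     (\<forall>t\<ge>0. distr M borel (X t) = distr M borel (\<lambda>\<omega>. - X t \<omega>))"

definition non_atomic :: "real measure \<Rightarrow> bool" where
  "non_atomic \<mu> \<longleftrightarrow> (\<forall>x. emeasure \<mu> {x} = 0)"

definition path_hull ::
    "(real \<Rightarrow> 'w \<Rightarrow> 'a::real_normed_vector) \<Rightarrow> real \<Rightarrow> 'w \<Rightarrow> 'a set" where
  "path_hull X s \<omega> = closure (convex hull ((\<lambda>t. X t \<omega>) ` {0..s}))"

end

theory Submission
  imports Defs
begin

text \<open>Choose times t j = 1/n decreasing to 0 (so that non-atomicity carries over from time 1), fast
  enough that X (t j) tends to 0 almost surely, and put S j = X (t j) - X 0, or S j = X s - X (s - t j)
  for the second claim. The differences S j - S (j + 1) are independent, and S j is the sum of those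
  with index at least j. The convex cone of all u with S j \<bullet> u \<ge> 0 for all large j is a tail object, so
  by Kolmogorov's 0-1 law its closure is almost surely deterministic. Were it nontrivial, a fixed
  nonzero u in the relative interior would lie in the cone almost surely, whereas by symmetry and
  non-atomicity S j \<bullet> u \<ge> 0 has probability at most 1/2. Hence the cone is trivial, and no hyperplane
  through 0 supports the hull of the S j.\<close>

section \<open>Deterministic and random convex sets\<close>

text \<open>Closed balls of rational radius centred in a dense set are a fine enough test family, so
  with countable \<open>D\<close> the closure of a set is fixed by countably many hitting
  events.\<close>

lemma closure_subset_of_cballs:
  fixes A B :: "'a::metric_space set"
  assumes dense: "\<And>U. open U \<Longrightarrow> U \<noteq> {} \<Longrightarrow> \<exists>d\<in>D. d \<in> U"
    and meet: "\<And>a q. a \<in> D \<Longrightarrow> q \<in> \<rat> \<Longrightarrow> A \<inter> cball a q \<noteq> {} \<Longrightarrow> B \<inter> cball a q \<noteq> {}"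
  shows "closure A \<subseteq> closure B"
proof
  fix x assume x: "x \<in> closure A"
  show "x \<in> closure B"
    unfolding closure_approachable
  proof (intro allI impI)
    fix e :: real assume e: "0 < e"
    obtain y where y: "y \<in> A" "dist y x < e/4"
      using x e unfolding closure_approachable by (metis zero_less_divide_iff zero_less_numeral)
    obtain a where a: "a \<in> D" "a \<in> ball y (e/4)"
      using dense[of "ball y (e/4)"] e by auto
    \<comment> \<open>\<open>q > e/4\<close> puts \<open>y\<close> in the ball about
      \<open>a\<close>; \<open>q < e/2\<close> keeps the three distances below \<open>e\<close> in
      total.\<close>
    obtain q where q: "q \<in> \<rat>" "e/4 < q" "q < e/2"
      using Rats_dense_in_real[of "e/4" "e/2"] e by auto
    have "y \<in> A \<inter> cball a q" using y a q by (auto simp: dist_commute)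
    then obtain z where z: "z \<in> B" "dist a z \<le> q"
      using meet[OF a(1) q(1)] by (metis Int_iff all_not_in_conv mem_cball)
    have "dist z x \<le> dist z a + dist a y + dist y x"
      using dist_triangle[of z x a] dist_triangle[of a x y] by linarith
    also have "\<dots> < e" using y a q z by (auto simp: dist_commute)
    finally show "\<exists>z\<in>B. dist z x < e" using z by blast
  qed
qed

text \<open>Compactness trades an existential over \<open>K\<close> for one over a dense subset,
  which can be countable: points of \<open>D\<close> that nearly satisfy finitely many inequalities
  accumulate at a point of \<open>K\<close> satisfying them all.\<close>

lemma compact_common_nonneg_iff:
  fixes T :: "nat \<Rightarrow> 'a::euclidean_space"
  assumes K: "compact K" and D: "D \<subseteq> K" "K \<subseteq> closure D"
  shows "(\<exists>u\<in>K. \<forall>j. 0 \<le> T j \<bullet> u) \<longleftrightarrow> (\<forall>n. \<exists>u\<in>D. \<forall>j\<in>{..<n}. - (1 / real (Suc n)) < T j \<bullet> u)"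
proof
  assume "\<exists>u\<in>K. \<forall>j. 0 \<le> T j \<bullet> u"
  then obtain u where u: "u \<in> K" "\<And>j. 0 \<le> T j \<bullet> u" by auto
  show "\<forall>n. \<exists>u\<in>D. \<forall>j\<in>{..<n}. - (1 / real (Suc n)) < T j \<bullet> u"
  proof
    fix n
    \<comment> \<open>The slack makes the constraints strict at \<open>u\<close>, so they cut out an
      open neighbourhood of \<open>u\<close>, which meets \<open>D\<close>.\<close>
    define U where "U = (\<Inter>j\<in>{..<n}. {v. - (1 / real (Suc n)) < T j \<bullet> v})"
    have "open U" unfolding U_def
      by (intro open_INT finite_lessThan ballI open_Collect_less continuous_intros)
    moreover have "u \<in> U" unfolding U_def using u(2)
      by (auto intro: less_le_trans[of _ 0])
    moreover have "u \<in> closure D" using u D by auto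
    ultimately have "U \<inter> D \<noteq> {}" using closure_iff_nhds_not_empty[of u D] by blast
    then show "\<exists>u\<in>D. \<forall>j\<in>{..<n}. - (1 / real (Suc n)) < T j \<bullet> u" unfolding U_def by blast
  qed
next
  assume "\<forall>n. \<exists>u\<in>D. \<forall>j\<in>{..<n}. - (1 / real (Suc n)) < T j \<bullet> u"
  then obtain u where u: "\<And>n. u n \<in> D" "\<And>n j. j < n \<Longrightarrow> - (1 / real (Suc n)) < T j \<bullet> u n"
    by (metis lessThan_iff)
  have "seq_compact K" "\<forall>n. u n \<in> K" using K u D by (auto simp: compact_imp_seq_compact)
  then obtain l r where l: "l \<in> K" "strict_mono r" "(u \<circ> r) \<longlonglongrightarrow> l" by (rule seq_compactE)
  have "0 \<le> T j \<bullet> l" for j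
  proof (rule LIMSEQ_le)
    show "(\<lambda>n. T j \<bullet> (u \<circ> r) n) \<longlonglongrightarrow> T j \<bullet> l" by (intro tendsto_intros l)
    have "(\<lambda>n. - (1 / real (Suc n))) \<longlonglongrightarrow> - 0"
      by (intro tendsto_minus LIMSEQ_Suc[OF lim_1_over_n])
    then show "(\<lambda>n. - (1 / real (Suc (r n)))) \<longlonglongrightarrow> 0"
      using LIMSEQ_subseq_LIMSEQ[OF _ l(2)] by (fastforce simp: o_def)
    show "\<exists>N. \<forall>n\<ge>N. - (1 / real (Suc (r n))) \<le> T j \<bullet> (u \<circ> r) n"
    proof (intro exI allI impI)
      \<comment> \<open>From here on \<open>r n \<ge> n > j\<close>, so the \<open>j\<close>-th
        constraint is among those imposed on \<open>u (r n)\<close>.\<close>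
      fix n assume "Suc j \<le> n"
      then have "j < r n" using seq_suble[OF l(2), of n] by linarith
      from u(2)[OF this] show "- (1 / real (Suc (r n))) \<le> T j \<bullet> (u \<circ> r) n" by simp
    qed
  qed
  then show "\<exists>u\<in>K. \<forall>j. 0 \<le> T j \<bullet> u" using l by auto
qed

text \<open>The space \<open>N\<close> is arbitrary so that the sigma-algebra generated by the late
  variables of a sequence can be inserted for it.\<close>

lemma sets_ex_common_nonneg:
  fixes T :: "nat \<Rightarrow> 'w \<Rightarrow> 'a::euclidean_space"
  assumes T[measurable]: "\<And>j. T j \<in> borel_measurable N" and K: "compact K"
  shows "{\<omega>\<in>space N. \<exists>u\<in>K. \<forall>j. 0 \<le> T j \<omega> \<bullet> u} \<in> sets N"
proof -
  obtain D where D: "countable D" "D \<subseteq> K" "K \<subseteq> closure D" using separable by metis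
  have "{\<omega>\<in>space N. \<forall>n. \<exists>u\<in>D. \<forall>j\<in>{..<n}. - (1 / real (Suc n)) < T j \<omega> \<bullet> u} \<in> sets N"
  proof (rule sets.sets_Collect_countable_All)
    fix n :: nat
    show "{\<omega>\<in>space N. \<exists>u\<in>D. \<forall>j\<in>{..<n}. - (1 / real (Suc n)) < T j \<omega> \<bullet> u} \<in> sets N"
      by (rule sets.sets_Collect_countable_Ex'[OF _ D(1)]) measurable
  qed
  then show ?thesis by (simp only: compact_common_nonneg_iff[OF K D(2,3)])
qed

text \<open>Either the interior is empty and \<open>C\<close> lies in a hyperplane, whose normal can
  be signed suitably, or \<open>0\<close> is separated from the interior and the inequality passes
  to the closure of the interior, which contains \<open>C\<close>.\<close>

lemma nonneg_functional_of_not_interior: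
  fixes C :: "'a::euclidean_space set"
  assumes C: "convex C" and 0: "0 \<notin> interior C"
  obtains u where "u \<noteq> 0" "\<And>x. x \<in> C \<Longrightarrow> 0 \<le> x \<bullet> u"
proof (cases "interior C = {}")
  case True
  obtain a b where ab: "a \<noteq> 0" "C \<subseteq> {x. a \<bullet> x = b}"
    using empty_interior_subset_hyperplane[OF C True] .
  show ?thesis
  proof (cases "0 \<le> b")
    case True then show ?thesis using ab by (intro that[of a]) (auto simp: inner_commute)
  next
    case False then show ?thesis using ab by (intro that[of "-a"]) (auto simp: inner_commute)
  qed
next
  case False
  obtain a where a: "a \<noteq> 0" "\<And>x. x \<in> interior C \<Longrightarrow> 0 \<le> a \<bullet> x"
    using separating_hyperplane_set_0[OF convex_interior[OF C] 0] by auto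
  have "closure (interior C) \<subseteq> {x. 0 \<le> a \<bullet> x}"
    using a by (intro closure_minimal closed_Collect_le continuous_intros) auto
  then have "C \<subseteq> {x. 0 \<le> a \<bullet> x}"
    using convex_closure_interior[OF C False] closure_subset by blast
  then show ?thesis using a by (intro that[of a]) (auto simp: inner_commute)
qed

text \<open>The relative interior of a convex set depends only on the closure, and it has a nonzero
  point as soon as the set does.\<close>

lemma convex_common_element:
  fixes Q :: "'a::euclidean_space set"
  assumes "convex Q" "\<not> Q \<subseteq> {0}"
  obtains u where "u \<noteq> 0" "\<And>P. convex P \<Longrightarrow> closure P = closure Q \<Longrightarrow> u \<in> P"
proof -
  have "\<not> rel_interior Q \<subseteq> {0}"
  proof
    assume "rel_interior Q \<subseteq> {0}"
    then have "closure Q \<subseteq> {0}"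
      using convex_closure_rel_interior[OF assms(1)] closure_mono[of "rel_interior Q" "{0}"] by simp
    then show False using assms(2) closure_subset by blast
  qed
  then obtain u where u: "u \<in> rel_interior Q" "u \<noteq> 0" by auto
  show ?thesis
  proof (rule that[OF u(2)])
    fix P assume "convex P" "closure P = closure Q"
    then have "rel_interior P = rel_interior Q" by (metis assms(1) convex_rel_interior_closure)
    then show "u \<in> P" using u rel_interior_subset by blast
  qed
qed

text \<open>A random convex set whose hitting events are trivial has a deterministic closure, and the
  relative interior of a convex set is determined by its closure.\<close>
lemma (in prob_space) deterministic_element_of_random_convex:
  fixes P :: "'a \<Rightarrow> 'b::euclidean_space set"
  assumes conv: "\<And>\<omega>. convex (P \<omega>)"
    and meas: "\<And>K. compact K \<Longrightarrow> {\<omega>\<in>space M. P \<omega> \<inter> K \<noteq> {}} \<in> events"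
    and triv: "\<And>K. compact K \<Longrightarrow>
      prob {\<omega>\<in>space M. P \<omega> \<inter> K \<noteq> {}} = 0 \<or> prob {\<omega>\<in>space M. P \<omega> \<inter> K \<noteq> {}} = 1"
  shows "(AE \<omega> in M. P \<omega> \<subseteq> {0}) \<or> (\<exists>u. u \<noteq> 0 \<and> (AE \<omega> in M. u \<in> P \<omega>))"
proof -
  obtain D :: "'b set" where D: "countable D" "\<And>U. open U \<Longrightarrow> U \<noteq> {} \<Longrightarrow> \<exists>d\<in>D. d \<in> U"
    using countable_dense_setE by metis
  \<comment> \<open>For compact \<open>K\<close>, \<open>b K\<close> is the deterministic truth
    value that hitting \<open>K\<close> takes almost surely.\<close>
  define b where "b K \<longleftrightarrow> prob {\<omega>\<in>space M. P \<omega> \<inter> K \<noteq> {}} = 1" for K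
  have b: "AE \<omega> in M. (P \<omega> \<inter> K \<noteq> {}) \<longleftrightarrow> b K" if K: "compact K" for K
  proof (cases "b K")
    case True
    then have "AE \<omega> in M. \<omega> \<in> {\<omega>\<in>space M. P \<omega> \<inter> K \<noteq> {}}"
      using prob_eq_1[OF meas[OF K]] unfolding b_def by blast
    then show ?thesis using True by auto
  next
    case False
    then have "AE \<omega> in M. \<omega> \<notin> {\<omega>\<in>space M. P \<omega> \<inter> K \<noteq> {}}"
      using triv[OF K] prob_eq_0[OF meas[OF K]] unfolding b_def by blast
    then show ?thesis
      by (rule AE_mp) (use False in \<open>auto intro!: AE_I2\<close>)
  qed
  have "AE \<omega> in M. \<forall>p\<in>D \<times> \<rat>. (P \<omega> \<inter> cball (fst p) (snd p) \<noteq> {}) \<longleftrightarrow> b (cball (fst p) (snd p))"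
    using D(1) by (subst AE_ball_countable) (auto simp: countable_rat intro!: b)
  then have AE: "AE \<omega> in M. \<forall>a\<in>D. \<forall>q\<in>\<rat>. (P \<omega> \<inter> cball a q \<noteq> {}) \<longleftrightarrow> b (cball a q)"
    by eventually_elim auto
  \<comment> \<open>Outside one null set all the countably many ball tests agree with
    \<open>b\<close>. Any such outcome serves as reference, and \<open>closure (P \<omega>0)\<close>
    is the deterministic closure.\<close>
  then obtain \<omega>0 where \<omega>0: "\<forall>a\<in>D. \<forall>q\<in>\<rat>. (P \<omega>0 \<inter> cball a q \<noteq> {}) \<longleftrightarrow> b (cball a q)"
    using eventually_happens'[OF ae_filter_bot] by blast
  from AE have cl: "AE \<omega> in M. closure (P \<omega>) = closure (P \<omega>0)"
  proof eventually_elim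
    case (elim \<omega>)
    show ?case
    proof
      show "closure (P \<omega>) \<subseteq> closure (P \<omega>0)"
        by (rule closure_subset_of_cballs[OF D(2)]) (use elim \<omega>0 in auto)
      show "closure (P \<omega>0) \<subseteq> closure (P \<omega>)"
        by (rule closure_subset_of_cballs[OF D(2)]) (use elim \<omega>0 in auto)
    qed
  qed
  show ?thesis
  proof (cases "P \<omega>0 \<subseteq> {0}")
    case True
    have "closure (P \<omega>0) \<subseteq> {0}" using closure_mono[OF True] by simp
    then have "P \<omega> \<subseteq> {0}" if "closure (P \<omega>) = closure (P \<omega>0)" for \<omega>
      using closure_subset[of "P \<omega>"] that by blast
    with cl have "AE \<omega> in M. P \<omega> \<subseteq> {0}" by (auto elim: eventually_mono)
    then show ?thesis ..
  next
    case False
    obtain u where u: "u \<noteq> 0" "\<And>R. convex R \<Longrightarrow> closure R = closure (P \<omega>0) \<Longrightarrow> u \<in> R"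
      using convex_common_element[OF conv False] by metis
    from cl have "AE \<omega> in M. u \<in> P \<omega>" by eventually_elim (use u conv in blast)
    then show ?thesis using u by blast
  qed
qed

section \<open>Independence, the zero-one law and tail sums\<close>

text \<open>Intended for reversing a finite list of increments: these are independent in increasing
  time order, whereas times decreasing to 0 number them backwards.\<close>

lemma (in prob_space) indep_vars_reindex:
  assumes ind: "indep_vars (\<lambda>i. N (f i)) (\<lambda>i. Y (f i)) I" and inj: "inj_on f I"
  shows "indep_vars N Y (f ` I)"
  unfolding indep_vars_def2 indep_sets_def
proof (intro conjI ballI allI impI)
  fix i assume "i \<in> f ` I"
  then show rv: "random_variable (N i) (Y i)" using ind by (auto simp: indep_vars_def2)
  show "{Y i -` A \<inter> space M |A. A \<in> sets (N i)} \<subseteq> events"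
    using rv by (auto intro: measurable_sets)
next
  fix J A
  assume J: "J \<subseteq> f ` I" "J \<noteq> {}" "finite J"
    and A: "A \<in> Pi J (\<lambda>i. {Y i -` B \<inter> space M |B. B \<in> sets (N i)})"
  obtain L where L: "L \<subseteq> I" "J = f ` L" using J(1) by (meson subset_imageE)
  have injL: "inj_on f L" using inj L(1) by (rule inj_on_subset)
  have "finite L" "L \<noteq> {}" using J L injL by (auto dest: finite_imageD)
  moreover have "\<forall>l\<in>L. A (f l) \<in> {Y (f l) -` B \<inter> space M |B. B \<in> sets (N (f l))}"
    using A L(2) by (auto simp: Pi_iff)
  ultimately have "prob (\<Inter>l\<in>L. A (f l)) = (\<Prod>l\<in>L. prob (A (f l)))"
    using ind L(1) by (intro indep_setsD[of _ I]) (auto simp: indep_vars_def2)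
  then show "prob (\<Inter>j\<in>J. A j) = (\<Prod>j\<in>J. prob (A j))"
    unfolding L(2) by (simp add: prod.reindex[OF injL] image_image)
qed

text \<open>Independence concerns finite subfamilies only, and a finite set of naturals lies in an
  initial segment.\<close>

lemma (in prob_space) indep_vars_UNIV_nat:
  assumes "\<And>n::nat. indep_vars N Y {..<n}"
  shows "indep_vars N Y UNIV"
proof -
  have "random_variable (N i) (Y i)" for i
    using assms[of "Suc i"] by (auto simp: indep_vars_def2)
  moreover have "indep_sets (\<lambda>i. {Y i -` A \<inter> space M |A. A \<in> sets (N i)}) J" if "finite J" for J
  proof -
    obtain n where "J \<subseteq> {..<n}" using \<open>finite J\<close> by (auto simp: finite_nat_iff_bounded)
    then show ?thesis using indep_vars_subset[OF assms] by (simp add: indep_vars_def2)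
  qed
  ultimately show ?thesis
    unfolding indep_vars_def2 by (subst indep_sets_finite_index_sets) auto
qed

lemma convex_eventually_nonneg:
  "convex {u::'a::real_inner. \<exists>k. \<forall>j\<ge>k. 0 \<le> (S::nat \<Rightarrow> 'a) j \<bullet> u}"
proof (rule convexI)
  fix u v :: 'a and a b :: real
  assume uv: "u \<in> {u. \<exists>k. \<forall>j\<ge>k. 0 \<le> S j \<bullet> u}" "v \<in> {u. \<exists>k. \<forall>j\<ge>k. 0 \<le> S j \<bullet> u}"
    and ab: "0 \<le> a" "0 \<le> b"
  obtain k l where kl: "\<And>j. j \<ge> k \<Longrightarrow> 0 \<le> S j \<bullet> u" "\<And>j. j \<ge> l \<Longrightarrow> 0 \<le> S j \<bullet> v" using uv by auto
  have "\<forall>j\<ge>max k l. 0 \<le> S j \<bullet> (a *\<^sub>R u + b *\<^sub>R v)"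
    using kl ab by (auto simp: inner_add_right)
  then show "a *\<^sub>R u + b *\<^sub>R v \<in> {u. \<exists>k. \<forall>j\<ge>k. 0 \<le> S j \<bullet> u}" by blast
qed

text \<open>The events that \<open>Q\<close> holds from \<open>k\<close> on increase with
  \<open>k\<close>, and each lies inside a single event of probability at most \<open>c\<close>, so
  their union cannot have probability 1.\<close>

lemma (in prob_space) not_AE_eventually_of_prob_le:
  assumes meas: "\<And>j::nat. {\<omega>\<in>space M. Q j \<omega>} \<in> events"
    and le: "\<And>j. prob {\<omega>\<in>space M. Q j \<omega>} \<le> c" and c: "c < 1"
  shows "\<not> (AE \<omega> in M. \<exists>k. \<forall>j\<ge>k. Q j \<omega>)"
proof
  assume AE: "AE \<omega> in M. \<exists>k. \<forall>j\<ge>k. Q j \<omega>"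
  define E where "E k = {\<omega>\<in>space M. \<forall>j\<in>{k..}. Q j \<omega>}" for k
  have E: "E k \<in> events" for k
    unfolding E_def by (rule sets.sets_Collect_countable_All') (use meas in auto)
  have "incseq E" unfolding E_def by (auto simp: incseq_def)
  then have lim: "(\<lambda>k. prob (E k)) \<longlonglongrightarrow> prob (\<Union>k. E k)"
    using E by (intro finite_Lim_measure_incseq) auto
  have "prob (E k) \<le> c" for k
    using le[of k] finite_measure_mono[OF _ meas[of k], of "E k"] unfolding E_def by fastforce
  then have "prob (\<Union>k. E k) \<le> c" by (intro LIMSEQ_le_const2[OF lim]) auto
  moreover have "AE \<omega> in M. \<omega> \<in> (\<Union>k. E k)"
    using AE AE_space by eventually_elim (auto simp: E_def)
  then have "prob (\<Union>k. E k) = 1" using E by (subst prob_eq_1) auto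
  ultimately show False using c by simp
qed

text \<open>Taking \<open>S j\<close> to be a series in \<open>V j\<close>,
  \<open>V (j + 1)\<close>, ... makes its dependence on late variables exact for every outcome, so
  that the cone \<open>P\<close> yields tail events. Were \<open>P\<close> not almost surely
  trivial, it would almost surely contain a fixed nonzero vector, against the bound
  \<open>c\<close>.\<close>

lemma (in prob_space) AE_interior_hull_tail_sums:
  fixes V :: "nat \<Rightarrow> 'a \<Rightarrow> 'b::euclidean_space" and S :: "nat \<Rightarrow> 'a \<Rightarrow> 'b"
  defines "S \<equiv> \<lambda>j \<omega>. \<Sum>i. V (j + i) \<omega>"
  assumes ind: "indep_vars (\<lambda>_. borel) V UNIV"
    and c: "c < 1" "\<And>u j. u \<noteq> 0 \<Longrightarrow> prob {\<omega>\<in>space M. 0 \<le> S j \<omega> \<bullet> u} \<le> c"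
  shows "AE \<omega> in M. 0 \<in> interior (convex hull (range (\<lambda>j. S j \<omega>)))"
proof -
  define A where "A i = sigma_sets (space M) {V i -` B \<inter> space M | B. B \<in> sets borel}" for i
  define P where "P \<omega> = {u. \<exists>k. \<forall>j\<ge>k. 0 \<le> S j \<omega> \<bullet> u}" for \<omega>
  define H where "H K = {\<omega>\<in>space M. P \<omega> \<inter> K \<noteq> {}}" for K
  have A: "indep_sets A UNIV" using ind unfolding indep_vars_def A_def by simp
  have A_sa: "sigma_algebra (space M) (A i)" for i
    unfolding A_def by (rule sigma_algebra_sigma_sets) auto
  have V[measurable]: "V i \<in> borel_measurable M" for i using ind unfolding indep_vars_def by simp
  have S[measurable]: "S i \<in> borel_measurable M" for i unfolding S_def by measurable
  have tail: "H K \<in> tail_events A" if K: "compact K" for K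
    unfolding tail_events_def
  proof
    fix n
    \<comment> \<open>\<open>N\<close> carries the sigma-algebra generated by the \<open>V i\<close>
      with \<open>i \<ge> n\<close>.\<close>
    define N where "N = sigma (space M) (\<Union> (A ` {n..}))"
    have sub: "\<Union> (A ` {n..}) \<subseteq> Pow (space M)"
      using A sets.space_closed[of M] unfolding indep_sets_def by blast
    have sp: "space N = space M" and se: "sets N = sigma_sets (space M) (\<Union> (A ` {n..}))"
      using sub by (auto simp: N_def space_measure_of sets_measure_of)
    have VN: "V i \<in> borel_measurable N" if "n \<le> i" for i
    proof (rule measurableI)
      fix B :: "'b set" assume "B \<in> sets borel"
      then have "V i -` B \<inter> space M \<in> A i" unfolding A_def by (auto intro: sigma_sets.Basic)
      then show "V i -` B \<inter> space N \<in> sets N"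
        unfolding se sp using that by (intro sigma_sets.Basic) auto
    qed simp
    \<comment> \<open>\<open>suminf\<close> takes a default value where the series diverges, so
      \<open>S i\<close> is a measurable function of the late variables everywhere.\<close>
    have SN: "S i \<in> borel_measurable N" if "n \<le> i" for i
      unfolding S_def using that by (intro borel_measurable_suminf VN) auto
    \<comment> \<open>Raising a threshold \<open>k\<close> to \<open>max n k\<close> keeps it valid,
      so only the \<open>S i\<close> with \<open>i \<ge> n\<close> are consulted.\<close>
    have iff: "(\<exists>u. u \<in> P \<omega> \<and> u \<in> K) \<longleftrightarrow> (\<exists>k\<in>{n..}. \<exists>u\<in>K. \<forall>j. 0 \<le> S (j + k) \<omega> \<bullet> u)" for \<omega>
    proof
      assume "\<exists>u. u \<in> P \<omega> \<and> u \<in> K"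
      then obtain u k where u: "u \<in> K" "\<And>j. j \<ge> k \<Longrightarrow> 0 \<le> S j \<omega> \<bullet> u" unfolding P_def by auto
      then show "\<exists>k\<in>{n..}. \<exists>u\<in>K. \<forall>j. 0 \<le> S (j + k) \<omega> \<bullet> u"
        by (intro bexI[of _ "max n k"] bexI[of _ u]) auto
    next
      assume "\<exists>k\<in>{n..}. \<exists>u\<in>K. \<forall>j. 0 \<le> S (j + k) \<omega> \<bullet> u"
      then obtain k u where u: "u \<in> K" "\<And>j. 0 \<le> S (j + k) \<omega> \<bullet> u" by auto
      have "0 \<le> S j \<omega> \<bullet> u" if "j \<ge> k" for j using u(2)[of "j - k"] that by simp
      then show "\<exists>u. u \<in> P \<omega> \<and> u \<in> K" using u(1) unfolding P_def by blast
    qed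
    have "{\<omega>\<in>space N. \<exists>k\<in>{n..}. \<exists>u\<in>K. \<forall>j. 0 \<le> S (j + k) \<omega> \<bullet> u} \<in> sets N"
      by (rule sets.sets_Collect_countable_Ex') (auto intro!: sets_ex_common_nonneg SN K)
    moreover have "H K = {\<omega>\<in>space N. \<exists>k\<in>{n..}. \<exists>u\<in>K. \<forall>j. 0 \<le> S (j + k) \<omega> \<bullet> u}"
      unfolding H_def sp iff[symmetric] by blast
    ultimately show "H K \<in> sigma_sets (space M) (\<Union> (A ` {n..}))" using se by simp
  qed
  have H: "H K \<in> events" if "compact K" for K
    using tail[OF that] tail_events_sets[of A] A unfolding indep_sets_def by blast
  have "(AE \<omega> in M. P \<omega> \<subseteq> {0}) \<or> (\<exists>u. u \<noteq> 0 \<and> (AE \<omega> in M. u \<in> P \<omega>))"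
  proof (rule deterministic_element_of_random_convex)
    show "convex (P \<omega>)" for \<omega> unfolding P_def by (rule convex_eventually_nonneg)
  qed (use H kolmogorov_0_1_law[OF A_sa A tail] in \<open>auto simp: H_def\<close>)
  moreover have "\<not> (AE \<omega> in M. u \<in> P \<omega>)" if "u \<noteq> 0" for u
    unfolding P_def mem_Collect_eq
    by (rule not_AE_eventually_of_prob_le[OF _ c(2)[OF that] c(1)]) measurable
  ultimately have "AE \<omega> in M. P \<omega> \<subseteq> {0}" by blast
  then show ?thesis
  proof eventually_elim
    case (elim \<omega>)
    show ?case
    proof (rule ccontr)
      assume "0 \<notin> interior (convex hull (range (\<lambda>j. S j \<omega>)))"
      then obtain u where u: "u \<noteq> 0" "\<And>x. x \<in> convex hull (range (\<lambda>j. S j \<omega>)) \<Longrightarrow> 0 \<le> x \<bullet> u"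
        using nonneg_functional_of_not_interior[OF convex_convex_hull] by metis
      \<comment> \<open>A vector nonnegative on the whole hull lies in the cone with threshold
        0.\<close>
      have "u \<in> P \<omega>" unfolding P_def using u(2)[OF hull_inc] by auto
      then show False using elim u(1) by auto
    qed
  qed
qed

text \<open>A null sequence is the telescoping sum of its later differences. This identity holds
  only almost surely, so the claim is proved for the series \<open>T\<close> and transferred to
  \<open>S\<close>.\<close>

lemma (in prob_space) AE_interior_hull_null_sequence:
  fixes S :: "nat \<Rightarrow> 'a \<Rightarrow> 'b::euclidean_space"
  assumes rv[measurable]: "\<And>j. random_variable borel (S j)"
    and ind: "indep_vars (\<lambda>_. borel) (\<lambda>j \<omega>. S j \<omega> - S (Suc j) \<omega>) UNIV"
    and lim: "AE \<omega> in M. (\<lambda>j. S j \<omega>) \<longlonglongrightarrow> 0"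
    and c: "c < 1" "\<And>u j. u \<noteq> 0 \<Longrightarrow> prob {\<omega>\<in>space M. 0 \<le> S j \<omega> \<bullet> u} \<le> c"
  shows "AE \<omega> in M. 0 \<in> interior (convex hull (range (\<lambda>j. S j \<omega>)))"
proof -
  define T where "T j \<omega> = (\<Sum>i. S (j + i) \<omega> - S (Suc (j + i)) \<omega>)" for j \<omega>
  have T[measurable]: "T j \<in> borel_measurable M" for j unfolding T_def by measurable
  from lim have eq: "AE \<omega> in M. \<forall>j. T j \<omega> = S j \<omega>"
  proof eventually_elim
    case (elim \<omega>)
    show ?case
    proof
      fix j
      have "(\<lambda>i. S (j + i) \<omega>) \<longlonglongrightarrow> 0"
        using LIMSEQ_ignore_initial_segment[OF elim, of j] by (simp add: add.commute)
      from telescope_sums'[OF this] show "T j \<omega> = S j \<omega>" unfolding T_def by (simp add: sums_iff)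
    qed
  qed
  have "AE \<omega> in M. 0 \<in> interior (convex hull (range (\<lambda>j. T j \<omega>)))"
    unfolding T_def
  proof (rule AE_interior_hull_tail_sums[OF ind c(1)])
    fix u :: 'b and j assume u: "u \<noteq> 0"
    have "prob {\<omega>\<in>space M. 0 \<le> T j \<omega> \<bullet> u} = prob {\<omega>\<in>space M. 0 \<le> S j \<omega> \<bullet> u}"
    proof (rule finite_measure_eq_AE)
      show "AE \<omega> in M. (\<omega> \<in> {\<omega>\<in>space M. 0 \<le> T j \<omega> \<bullet> u}) = (\<omega> \<in> {\<omega>\<in>space M. 0 \<le> S j \<omega> \<bullet> u})"
        using eq by eventually_elim simp
    qed measurable
    then show "prob {\<omega>\<in>space M. 0 \<le> (\<Sum>i. S (j + i) \<omega> - S (Suc (j + i)) \<omega>) \<bullet> u} \<le> c"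
      using c(2)[OF u] by (simp add: T_def)
  qed
  with eq show ?thesis by eventually_elim simp
qed

text \<open>By Borel-Cantelli, almost surely \<open>norm (S j \<omega>) > e j\<close> for only
  finitely many \<open>j\<close>.\<close>

lemma (in prob_space) AE_tendsto_0_of_summable_tails:
  fixes S :: "nat \<Rightarrow> 'a \<Rightarrow> 'b::real_normed_vector"
  assumes meas: "\<And>j. {\<omega>\<in>space M. norm (S j \<omega>) > e j} \<in> events"
    and e: "e \<longlonglongrightarrow> 0" and sum: "summable (\<lambda>j. prob {\<omega>\<in>space M. norm (S j \<omega>) > e j})"
  shows "AE \<omega> in M. (\<lambda>j. S j \<omega>) \<longlonglongrightarrow> 0"
proof -
  have "AE \<omega> in M. eventually (\<lambda>j. \<omega> \<in> space M - {\<omega>\<in>space M. norm (S j \<omega>) > e j}) sequentially"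
    using meas sum by (intro borel_cantelli_AE1) (auto simp: emeasure_eq_measure)
  then show ?thesis
  proof eventually_elim
    case (elim \<omega>)
    then have "\<forall>\<^sub>F j in sequentially. norm (S j \<omega>) \<le> e j"
      by eventually_elim auto
    then show ?case using e by (rule Lim_null_comparison)
  qed
qed

section \<open>Increments of the Levy process\<close>

context levy_process
begin

lemma prob_increment:
  assumes "0 \<le> t" "0 \<le> h" and B: "B \<in> sets borel"
  shows "prob {\<omega>\<in>space M. X (t + h) \<omega> - X t \<omega> \<in> B} = prob {\<omega>\<in>space M. X h \<omega> - X 0 \<omega> \<in> B}"
proof -
  have [measurable]: "random_variable borel (X t)" "random_variable borel (X (t + h))"
    "random_variable borel (X h)" "random_variable borel (X 0)"
    using assms by (auto intro!: random_variable_X)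
  have "measure (distr M borel (\<lambda>\<omega>. X (t + h) \<omega> - X t \<omega>)) B =
      measure (distr M borel (\<lambda>\<omega>. X h \<omega> - X 0 \<omega>)) B"
    using stationary_increments[of t h] assms by simp
  then show ?thesis
    using B by (simp add: measure_distr vimage_def Int_def conj_commute)
qed

text \<open>Non-atomicity is given at time 1. Cut the unit interval into \<open>n\<close>
  independent increments of equal law: if all are orthogonal to \<open>u\<close>, so is
  \<open>X 1\<close> almost surely, hence the \<open>n\<close>-th power of the probability is 0.
  This is why times of the form \<open>1 / n\<close> are used.\<close>

lemma prob_inner_increment_eq_0:
  assumes na: "non_atomic (distr M borel (\<lambda>\<omega>. X 1 \<omega> \<bullet> u))" and n: "0 < n"
  shows "prob {\<omega>\<in>space M. (X (1 / real n) \<omega> - X 0 \<omega>) \<bullet> u = 0} = 0"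
proof -
  define B where "B = {x. x \<bullet> u = 0}"
  have B: "B \<in> sets borel"
    unfolding B_def by (intro borel_closed closed_Collect_eq continuous_intros)
  define V where "V i \<omega> = X (real (Suc i) / real n) \<omega> - X (real i / real n) \<omega>" for i \<omega>
  have [measurable]: "random_variable borel (X 1)" "random_variable borel (X 0)"
    by (auto intro!: random_variable_X)
  have VI: "V i -` B \<inter> space M = {\<omega>\<in>space M. V i \<omega> \<in> B}" for i by auto
  have V: "prob (V i -` B \<inter> space M) = prob {\<omega>\<in>space M. (X (1 / real n) \<omega> - X 0 \<omega>) \<bullet> u = 0}" for i
    using prob_increment[of "real i / real n" "1 / real n" B] B n
    unfolding V_def VI by (simp add: B_def add_divide_distrib add.commute)
  have ind: "indep_vars (\<lambda>_. borel) V {..<n}"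
    unfolding V_def
    by (rule independent_increments[of "\<lambda>i. real i / real n"])
      (use n in \<open>auto simp: strict_mono_on_def divide_strict_right_mono\<close>)
  have "prob {\<omega>\<in>space M. (X (1 / real n) \<omega> - X 0 \<omega>) \<bullet> u = 0} ^ n =
      prob (\<Inter>i\<in>{..<n}. V i -` B \<inter> space M)"
    using indep_varsD_finite[OF ind, of "\<lambda>_. B"] B n by (auto simp: V)
  also have "\<dots> \<le> prob {\<omega>\<in>space M. X 1 \<omega> \<bullet> u = 0}"
  proof (rule finite_measure_mono_AE)
    show "AE \<omega> in M. \<omega> \<in> (\<Inter>i\<in>{..<n}. V i -` B \<inter> space M) \<longrightarrow> \<omega> \<in> {\<omega>\<in>space M. X 1 \<omega> \<bullet> u = 0}"
      using starts_at_origin AE_space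
    proof eventually_elim
      case (elim \<omega>)
      show ?case
      proof
        assume "\<omega> \<in> (\<Inter>i\<in>{..<n}. V i -` B \<inter> space M)"
        then have "V i \<omega> \<bullet> u = 0" if "i < n" for i using that unfolding B_def by blast
        then have "(\<Sum>i<n. V i \<omega>) \<bullet> u = 0" by (simp add: inner_sum_left)
        also have "(\<Sum>i<n. V i \<omega>) = X 1 \<omega>"
          unfolding V_def using sum_lessThan_telescope[of "\<lambda>i. X (real i / real n) \<omega>" n] n elim by simp
        finally show "\<omega> \<in> {\<omega>\<in>space M. X 1 \<omega> \<bullet> u = 0}" using elim by simp
      qed
    qed
  qed measurable
  also have "\<dots> = measure (distr M borel (\<lambda>\<omega>. X 1 \<omega> \<bullet> u)) {0}"
    by (simp add: measure_distr vimage_def Int_def conj_commute)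
  also have "\<dots> = 0" using na by (simp add: non_atomic_def measure_def)
  finally have "prob {\<omega>\<in>space M. (X (1 / real n) \<omega> - X 0 \<omega>) \<bullet> u = 0} ^ n = 0"
    by (rule antisym) simp
  then show ?thesis by simp
qed

text \<open>By symmetry the two closed half-spaces normal to \<open>u\<close> are equally likely,
  and their common boundary has probability 0, so neither exceeds one half.\<close>

lemma prob_inner_increment_nonneg:
  assumes sym: "symmetric_process M X" and t: "0 \<le> t"
    and 0: "prob {\<omega>\<in>space M. (X t \<omega> - X 0 \<omega>) \<bullet> u = 0} = 0"
  shows "prob {\<omega>\<in>space M. 0 \<le> (X t \<omega> - X 0 \<omega>) \<bullet> u} \<le> 1 / 2"
proof -
  have [measurable]: "random_variable borel (X t)" "random_variable borel (X 0)"
    using t by (auto intro!: random_variable_X)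
  \<comment> \<open>Symmetry speaks of \<open>X t\<close>, not of \<open>X t - X 0\<close>; the two
    agree almost surely because the process starts at the origin.\<close>
  have eq: "prob {\<omega>\<in>space M. Q ((X t \<omega> - X 0 \<omega>) \<bullet> u)} = prob {\<omega>\<in>space M. Q (X t \<omega> \<bullet> u)}"
    if [measurable]: "Measurable.pred borel Q" for Q
  proof (rule finite_measure_eq_AE)
    show "AE \<omega> in M. (\<omega> \<in> {\<omega>\<in>space M. Q ((X t \<omega> - X 0 \<omega>) \<bullet> u)}) = (\<omega> \<in> {\<omega>\<in>space M. Q (X t \<omega> \<bullet> u)})"
      using starts_at_origin by eventually_elim simp
  qed measurable
  have "prob {\<omega>\<in>space M. 0 \<le> X t \<omega> \<bullet> u} = measure (distr M borel (X t)) {x. 0 \<le> x \<bullet> u}"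
    by (simp add: measure_distr vimage_def Int_def conj_commute)
  also have "\<dots> = measure (distr M borel (\<lambda>\<omega>. - X t \<omega>)) {x. 0 \<le> x \<bullet> u}"
    using sym t by (simp add: symmetric_process_def)
  also have "\<dots> = prob {\<omega>\<in>space M. X t \<omega> \<bullet> u \<le> 0}"
    by (simp add: measure_distr vimage_def Int_def conj_commute)
  also have "\<dots> \<le> prob ({\<omega>\<in>space M. X t \<omega> \<bullet> u < 0} \<union> {\<omega>\<in>space M. X t \<omega> \<bullet> u = 0})"
    by (rule finite_measure_mono) (auto simp: less_le)
  also have "\<dots> \<le> prob {\<omega>\<in>space M. X t \<omega> \<bullet> u < 0} + prob {\<omega>\<in>space M. X t \<omega> \<bullet> u = 0}"
    by (rule measure_Un_le) measurable
  also have "prob {\<omega>\<in>space M. X t \<omega> \<bullet> u = 0} = 0" using 0 eq[of "\<lambda>x. x = 0"] by simp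
  also have "prob {\<omega>\<in>space M. X t \<omega> \<bullet> u < 0} = 1 - prob {\<omega>\<in>space M. 0 \<le> X t \<omega> \<bullet> u}"
    by (subst prob_compl[symmetric]) (auto intro!: arg_cong[of _ _ prob])
  finally show ?thesis using eq[of "\<lambda>x. 0 \<le> x"] by simp
qed

text \<open>Stochastic continuity at 0 makes the probabilities vanish along \<open>1 / n\<close>.
  The power \<open>(1 / 2) ^ j\<close> is both a threshold tending to 0 and a summable bound, as
  Borel-Cantelli requires.\<close>

lemma ex_sparse_times:
  assumes "0 < s"
  obtains m :: "nat \<Rightarrow> nat" where "strict_mono m" "\<And>j. 0 < m j" "\<And>j. 1 / real (m j) \<le> s"
    "\<And>j. prob {\<omega>\<in>space M. norm (X (1 / real (m j)) \<omega> - X 0 \<omega>) > (1 / 2) ^ j} \<le> (1 / 2) ^ j"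
proof -
  have "\<exists>N. \<forall>n\<ge>N. 1 / real n \<le> s \<and>
      prob {\<omega>\<in>space M. norm (X (1 / real n) \<omega> - X 0 \<omega>) > (1 / 2) ^ j} \<le> (1 / 2) ^ j" for j
  proof -
    \<comment> \<open>The filter excludes the point 0, hence the start at \<open>n = 1\<close>:
      division by zero gives \<open>1 / real 0 = 0\<close>.\<close>
    have "filterlim (\<lambda>n. 1 / real n) (at 0 within {0..}) sequentially"
      unfolding filterlim_at using lim_1_over_n
      by (auto simp: eventually_sequentially intro!: exI[of _ 1])
    from filterlim_compose[OF stochastically_continuous[of 0 "(1 / 2) ^ j"] this]
    have "(\<lambda>n. prob {\<omega>\<in>space M. norm (X (1 / real n) \<omega> - X 0 \<omega>) > (1 / 2) ^ j}) \<longlonglongrightarrow> 0" by simp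
    from order_tendstoD(2)[OF this, of "(1 / 2) ^ j"] order_tendstoD(2)[OF lim_1_over_n assms]
    have "\<forall>\<^sub>F n in sequentially. 1 / real n \<le> s \<and>
      prob {\<omega>\<in>space M. norm (X (1 / real n) \<omega> - X 0 \<omega>) > (1 / 2) ^ j} \<le> (1 / 2) ^ j"
      by (auto elim: eventually_elim2)
    then show ?thesis by (simp add: eventually_sequentially)
  qed
  then have "\<forall>j. \<exists>N. \<forall>n\<ge>N. 1 / real n \<le> s \<and>
      prob {\<omega>\<in>space M. norm (X (1 / real n) \<omega> - X 0 \<omega>) > (1 / 2) ^ j} \<le> (1 / 2) ^ j" ..
  from choice[OF this] obtain N where N: "\<And>j n. N j \<le> n \<Longrightarrow> 1 / real n \<le> s \<and>
      prob {\<omega>\<in>space M. norm (X (1 / real n) \<omega> - X 0 \<omega>) > (1 / 2) ^ j} \<le> (1 / 2) ^ j" by blast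
  \<comment> \<open>The partial sums dominate each \<open>N j\<close>, and the inner
    \<open>Suc\<close> makes \<open>m\<close> strictly increasing.\<close>
  define m where "m j = Suc (\<Sum>i\<le>j. Suc (N i))" for j
  have "N j \<le> m j" for j
    unfolding m_def using member_le_sum[of j "{..j}" "\<lambda>i. Suc (N i)"] by simp
  moreover have "strict_mono m" unfolding strict_mono_Suc_iff m_def by simp
  moreover have "0 < m j" for j by (simp add: m_def)
  ultimately show ?thesis using N by (intro that[of m]) blast+
qed

section \<open>Hulls at the two ends of the time interval\<close>

text \<open>Shared by both claims: \<open>S\<close> enters only through the laws of single terms and
  the independence of consecutive differences, which are available both forward from 0 and backward
  from \<open>s\<close>.\<close>

lemma AE_interior_hull_time_sequence:
  fixes S :: "nat \<Rightarrow> 'w \<Rightarrow> real ^ 'd"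
  assumes sym: "symmetric_process M X"
    and na: "\<And>u. u \<noteq> 0 \<Longrightarrow> non_atomic (distr M borel (\<lambda>\<omega>. X 1 \<omega> \<bullet> u))"
    and m: "\<And>j. 0 < m j"
      "\<And>j. prob {\<omega>\<in>space M. norm (X (1 / real (m j)) \<omega> - X 0 \<omega>) > (1 / 2) ^ j} \<le> (1 / 2) ^ j"
    and rv[measurable]: "\<And>j. random_variable borel (S j)"
    and law: "\<And>j B. B \<in> sets borel \<Longrightarrow>
      prob {\<omega>\<in>space M. S j \<omega> \<in> B} = prob {\<omega>\<in>space M. X (1 / real (m j)) \<omega> - X 0 \<omega> \<in> B}"
    and ind: "\<And>n. indep_vars (\<lambda>_. borel) (\<lambda>j \<omega>. S j \<omega> - S (Suc j) \<omega>) {..<n}"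
  shows "AE \<omega> in M. 0 \<in> interior (convex hull (range (\<lambda>j. S j \<omega>)))"
proof (rule AE_interior_hull_null_sequence[OF rv indep_vars_UNIV_nat[OF ind], where c = "1 / 2"])
  have tail: "prob {\<omega>\<in>space M. norm (S j \<omega>) > (1 / 2) ^ j} \<le> (1 / 2) ^ j" for j
    using m(2)[of j] law[of "{x. norm x > (1 / 2) ^ j}" j] by simp
  show "AE \<omega> in M. (\<lambda>j. S j \<omega>) \<longlonglongrightarrow> 0"
  proof (rule AE_tendsto_0_of_summable_tails)
    show "(\<lambda>j. (1 / 2) ^ j :: real) \<longlonglongrightarrow> 0" by (rule LIMSEQ_realpow_zero) auto
    show "summable (\<lambda>j. prob {\<omega>\<in>space M. norm (S j \<omega>) > (1 / 2) ^ j})"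
      by (rule summable_comparison_test'[OF summable_geometric[of "1 / 2 :: real"], of 0])
        (use tail in auto)
  qed measurable
next
  fix u :: "real ^ 'd" and j assume u: "u \<noteq> 0"
  show "prob {\<omega>\<in>space M. 0 \<le> S j \<omega> \<bullet> u} \<le> 1 / 2"
    using law[of "{x. 0 \<le> x \<bullet> u}" j]
      prob_inner_increment_nonneg[OF sym _ prob_inner_increment_eq_0[OF na[OF u] m(1)], of j]
    by simp
qed simp

lemma AE_interior_hull_start:
  assumes sym: "symmetric_process M X"
    and na: "\<And>u. u \<noteq> 0 \<Longrightarrow> non_atomic (distr M borel (\<lambda>\<omega>. X 1 \<omega> \<bullet> u))" and s: "0 < s"
  shows "AE \<omega> in M. 0 \<in> interior (convex hull ((\<lambda>t. X t \<omega>) ` {0..s}))"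
proof -
  obtain m where m: "strict_mono m" "\<And>j. 0 < m j" "\<And>j. 1 / real (m j) \<le> s"
    "\<And>j. prob {\<omega>\<in>space M. norm (X (1 / real (m j)) \<omega> - X 0 \<omega>) > (1 / 2) ^ j} \<le> (1 / 2) ^ j"
    using ex_sparse_times[OF s] by blast
  define S where "S j \<omega> = X (1 / real (m j)) \<omega> - X 0 \<omega>" for j \<omega>
  have "AE \<omega> in M. 0 \<in> interior (convex hull (range (\<lambda>j. S j \<omega>)))"
  proof (rule AE_interior_hull_time_sequence[OF sym na m(2,4)])
    show "random_variable borel (S j)" for j
      unfolding S_def by (intro borel_measurable_diff random_variable_X) auto
    show "prob {\<omega>\<in>space M. S j \<omega> \<in> B} = prob {\<omega>\<in>space M. X (1 / real (m j)) \<omega> - X 0 \<omega> \<in> B}" for j B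
      by (simp add: S_def)
    show "indep_vars (\<lambda>_. borel) (\<lambda>j \<omega>. S j \<omega> - S (Suc j) \<omega>) {..<n}" for n
    proof -
      \<comment> \<open>\<open>independent_increments\<close> wants increasing times, but
        \<open>1 / real (m j)\<close> decreases in \<open>j\<close>. After reversal the
        \<open>i\<close>-th increment is the difference with index \<open>n - Suc i\<close>.\<close>
      define t where "t i = 1 / real (m (n - i))" for i
      have "strict_mono_on {..n} t"
        unfolding t_def strict_mono_on_def using m(2) strict_monoD[OF m(1)]
        by (auto intro!: divide_strict_left_mono)
      moreover have "0 \<le> t 0" by (simp add: t_def)
      ultimately have "indep_vars (\<lambda>_. borel) (\<lambda>i \<omega>. X (t (Suc i)) \<omega> - X (t i) \<omega>) {..<n}"
        by (intro independent_increments)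
      moreover have "X (t (Suc i)) \<omega> - X (t i) \<omega> = S (n - Suc i) \<omega> - S (Suc (n - Suc i)) \<omega>"
        if "i < n" for i \<omega> using that by (simp add: S_def t_def Suc_diff_Suc)
      ultimately have "indep_vars (\<lambda>_. borel) (\<lambda>i \<omega>. S (n - Suc i) \<omega> - S (Suc (n - Suc i)) \<omega>) {..<n}"
        by (subst indep_vars_cong[OF refl _ refl]) auto
      then have "indep_vars (\<lambda>_. borel) (\<lambda>j \<omega>. S j \<omega> - S (Suc j) \<omega>) ((\<lambda>i. n - Suc i) ` {..<n})"
        by (rule indep_vars_reindex) (auto simp: inj_on_def)
      moreover have "(\<lambda>i. n - Suc i) ` {..<n} = {..<n}"
        by (rule endo_inj_surj) (auto simp: inj_on_def)
      ultimately show ?thesis by simp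
    qed
  qed
  with starts_at_origin show ?thesis
  proof eventually_elim
    case (elim \<omega>)
    \<comment> \<open>As \<open>X 0 \<omega> = 0\<close>, each \<open>S j \<omega>\<close> is itself
      a point of the path, at a time at most \<open>s\<close>.\<close>
    have "range (\<lambda>j. S j \<omega>) \<subseteq> (\<lambda>t. X t \<omega>) ` {0..s}" using elim(1) m(3) by (auto simp: S_def)
    then show ?case using elim(2) interior_mono[OF hull_mono] by blast
  qed
qed

text \<open>Seen backwards from \<open>s\<close>, the increments have the same laws by stationarity,
  so the endpoint takes over the role of the origin.\<close>

lemma AE_interior_hull_end:
  assumes sym: "symmetric_process M X"
    and na: "\<And>u. u \<noteq> 0 \<Longrightarrow> non_atomic (distr M borel (\<lambda>\<omega>. X 1 \<omega> \<bullet> u))" and s: "0 < s"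
  shows "AE \<omega> in M. X s \<omega> \<in> interior (convex hull ((\<lambda>t. X t \<omega>) ` {0..s}))"
proof -
  obtain m where m: "strict_mono m" "\<And>j. 0 < m j" "\<And>j. 1 / real (m j) \<le> s"
    "\<And>j. prob {\<omega>\<in>space M. norm (X (1 / real (m j)) \<omega> - X 0 \<omega>) > (1 / 2) ^ j} \<le> (1 / 2) ^ j"
    using ex_sparse_times[OF s] by blast
  define S where "S j \<omega> = X s \<omega> - X (s - 1 / real (m j)) \<omega>" for j \<omega>
  have "AE \<omega> in M. 0 \<in> interior (convex hull (range (\<lambda>j. S j \<omega>)))"
  proof (rule AE_interior_hull_time_sequence[OF sym na m(2,4)])
    show "random_variable borel (S j)" for j
      unfolding S_def using m(3)[of j] s by (intro borel_measurable_diff random_variable_X) auto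
    show "prob {\<omega>\<in>space M. S j \<omega> \<in> B} = prob {\<omega>\<in>space M. X (1 / real (m j)) \<omega> - X 0 \<omega> \<in> B}"
      if "B \<in> sets borel" for j B
      using prob_increment[of "s - 1 / real (m j)" "1 / real (m j)" B] m(3)[of j] that
      by (simp add: S_def)
    show "indep_vars (\<lambda>_. borel) (\<lambda>j \<omega>. S j \<omega> - S (Suc j) \<omega>) {..<n}" for n
    proof -
      \<comment> \<open>These times already increase with \<open>j\<close>, and
        \<open>S j - S (Suc j)\<close> is exactly the increment between two consecutive
        ones.\<close>
      have "strict_mono_on {..n} (\<lambda>i. s - 1 / real (m i))"
        unfolding strict_mono_on_def using m(2) strict_monoD[OF m(1)]
        by (auto intro!: divide_strict_left_mono)
      from independent_increments[OF _ this] show ?thesis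
        using m(3)[of 0] by (simp add: S_def)
    qed
  qed
  then show ?thesis
  proof eventually_elim
    case (elim \<omega>)
    \<comment> \<open>The point reflection \<open>?f\<close> sends \<open>X s \<omega>\<close> to 0
      and the path points at the chosen times to the \<open>S j \<omega>\<close>; it commutes with
      convex hull and interior.\<close>
    let ?f = "\<lambda>x. X s \<omega> + (-1) *\<^sub>R x"
    have "range (\<lambda>j. S j \<omega>) \<subseteq> ?f ` (\<lambda>t. X t \<omega>) ` {0..s}" using m(3) s
      by (fastforce simp: S_def image_image)
    then have "0 \<in> interior (convex hull (?f ` (\<lambda>t. X t \<omega>) ` {0..s}))"
      using elim interior_mono[OF hull_mono] by blast
    also have "\<dots> = (+) (X s \<omega>) ` uminus ` interior (convex hull ((\<lambda>t. X t \<omega>) ` {0..s}))"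
      unfolding convex_hull_affinity
      by (simp add: image_image interior_translation[symmetric] interior_negations[symmetric])
    finally show ?case by auto
  qed
qed

end

theorem theorem3p1:
  fixes M :: "'w measure" and X :: "real \<Rightarrow> 'w \<Rightarrow> real ^ 'd" and s :: real
  assumes "levy_process M X"
    and "symmetric_process M X"
    and "\<And>u :: real ^ 'd. u \<noteq> 0 \<Longrightarrow> non_atomic (distr M borel (\<lambda>\<omega>. X 1 \<omega> \<bullet> u))"
    and "0 < s"
  shows "(AE \<omega> in M. 0 \<in> interior (path_hull X s \<omega>)) \<and>
         (AE \<omega> in M. X s \<omega> \<in> interior (path_hull X s \<omega>))"
proof -
  interpret levy_process M X by fact
  \<comment> \<open>Both claims hold already for the hull before closing, and closing can only
    enlarge the interior.\<close>
  have sub: "interior (convex hull ((\<lambda>t. X t \<omega>) ` {0..s})) \<subseteq> interior (path_hull X s \<omega>)" for \<omega>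
    unfolding path_hull_def by (intro interior_mono closure_subset)
  have "AE \<omega> in M. 0 \<in> interior (convex hull ((\<lambda>t. X t \<omega>) ` {0..s}))"
    using assms(2-4) by (rule AE_interior_hull_start)
  moreover have "AE \<omega> in M. X s \<omega> \<in> interior (convex hull ((\<lambda>t. X t \<omega>) ` {0..s}))"
    using assms(2-4) by (rule AE_interior_hull_end)
  ultimately show ?thesis using subsetD[OF sub] by (blast intro: eventually_mono)
qed

end
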